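(* For every $t\in(0,1)$ there is $c\in(0,1)$ such that $|M_n(t)|\leq(c+o(1))^n$ as $n\to\infty$, i.e., there is a sequence $\varepsilon_n\to0$ with $|M_n(t)|\leq(c+\varepsilon_n)^n$ for all $n\geq 2$.
   Context: For $n\geq 2$, $j\geq 0$, $P^n_j$ denotes the Jacobi polynomial of degree $j$ with parameters $\alpha=\beta=(n-3)/2$, normalized so that $P^n_j(1)=1$. For $t\in(-1,1)$, $M_n(t)=\min\{P^n_j(t): j\geq 0\}$ (this minimum exists). *)

theory Defs
  imports Complex_Main "HOL-Computational_Algebra.Polynomial"
begin

text \<open>
  The Jacobi polynomials with parameters \<open>\<alpha>\<close>, \<open>\<beta>\<close> in their classical normalization, by the explicit
  formula of Szego, Orthogonal Polynomials, (4.3.2), where \<open>[:-1/2, 1/2:]\<close> is \<open>(x - 1)/2\<close> and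
  \<open>[:1/2, 1/2:]\<close> is \<open>(x + 1)/2\<close>.
\<close>

definition jacobi_poly :: "real \<Rightarrow> real \<Rightarrow> nat \<Rightarrow> real poly" where
  "jacobi_poly \<alpha> \<beta> j =
     (\<Sum>s\<le>j. smult (((real j + \<alpha>) gchoose (j - s)) * ((real j + \<beta>) gchoose s))
                ([:-1/2, 1/2:] ^ s * [:1/2, 1/2:] ^ (j - s)))"

definition Pn :: "nat \<Rightarrow> nat \<Rightarrow> real poly" where
  "Pn n j = (let \<alpha> = (real n - 3) / 2; J = jacobi_poly \<alpha> \<alpha> j in smult (1 / poly J 1) J)"

text \<open>
  The infimum equals the minimum whenever the minimum is attained (\<open>Mn_eq_minimum\<close>). For \<open>-1 < t < 1\<close>
  it is attained if \<open>n \<ge> 3\<close>; for \<open>n = 2\<close> the polynomials are the Chebyshev polynomials, whose values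
  \<open>cos (j * arccos t)\<close> need not attain their infimum.
\<close>

definition Mn :: "nat \<Rightarrow> real \<Rightarrow> real" where
  "Mn n t = (INF j. poly (Pn n j) t)"

lemma Mn_eq_minimum:
  assumes "\<And>j. poly (Pn n k) t \<le> poly (Pn n j) t"
  shows "Mn n t = poly (Pn n k) t"
  unfolding Mn_def by (rule cInf_eq_minimum) (use assms in auto)

lemma poly_jacobi_poly_1: "poly (jacobi_poly \<alpha> \<beta> j) 1 = (real j + \<alpha>) gchoose j"
proof -
  have "poly (jacobi_poly \<alpha> \<beta> j) 1 =
      (\<Sum>s\<le>j. if s = 0 then (real j + \<alpha>) gchoose j else 0)"
    unfolding jacobi_poly_def poly_sum by (rule sum.cong) (auto simp: zero_power)
  then show ?thesis
    by simp
qed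

lemma poly_Pn_1:
  assumes "n \<ge> 2"
  shows "poly (Pn n j) 1 = 1"
proof -
  have "0 < (real j + (real n - 3) / 2) gchoose j"
    unfolding gbinomial_prod_rev
    by (intro divide_pos_pos prod_pos) (use assms in \<open>auto simp: field_simps\<close>)
  then show ?thesis
    by (simp add: Pn_def poly_jacobi_poly_1 Let_def)
qed

end

(* Writing p j for the value of P^n_j at t, the three-term recurrence reads
     p (j + 2) = (1 + a j) * t * p (j + 1) - a j * p j,   a j = (j + 1) / (j + n - 1).
   The undamped case a j = 1 is the Chebyshev recurrence, which conserves the energy
     E j = (p (j + 1))^2 - 2 * t * p j * p (j + 1) + (p j)^2.
   With damping the energy decreases, and while a j <= 1/2, i.e. for j < n - 2, any two steps
   together shrink it by a factor that depends on t only. Hence p j is exponentially small in n once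
   j exceeds a fixed fraction of n. For smaller j the damping factors a j are so small that the
   recurrence keeps p j positive. *)
theory Submission
  imports Defs
begin

section \<open>The three-term recurrence\<close>

definition ucoeff :: "real \<Rightarrow> nat \<Rightarrow> real" where
  "ucoeff b s = 1 / (fact s * pochhammer b s)"

lemma ucoeff_Suc:
  assumes "b > 0"
  shows "ucoeff b s = (real s + 1) * (b + real s) * ucoeff b (Suc s)"
proof -
  have "real s + 1 \<noteq> 0" "b + real s \<noteq> 0"
    using assms by linarith+
  then show ?thesis
    by (simp add: ucoeff_def pochhammer_rec' add.commute)
qed

text \<open>The coefficients of \<open>f (X z) * f (Y z)\<close> where \<open>f z = (\<Sum>s. z ^ s / (s! (b)\<^sub>s))\<close>,
  weighted by \<open>g\<close>.\<close>

definition uconv :: "real \<Rightarrow> real \<Rightarrow> real \<Rightarrow> (real \<Rightarrow> real \<Rightarrow> real) \<Rightarrow> nat \<Rightarrow> real" where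
  "uconv b X Y g j =
     (\<Sum>s\<le>j. g (real s) (real (j - s)) * (ucoeff b s * X ^ s * (ucoeff b (j - s) * Y ^ (j - s))))"

text \<open>Multiplying by \<open>X\<close> turns the term with index \<open>s\<close> into the one
  with index \<open>s + 1\<close>. By \<open>ucoeff_Suc\<close> the change of coefficient is a
  polynomial factor, which the weight absorbs; this factor vanishes at the new index 0.\<close>

lemma uconv_mult_X:
  assumes "b > 0"
  shows "X * uconv b X Y g j = uconv b X Y (\<lambda>s k. s * (b + s - 1) * g (s - 1) k) (Suc j)"
proof -
  have shift: "X * (g (real s) (real (j - s))
        * (ucoeff b s * X ^ s * (ucoeff b (j - s) * Y ^ (j - s))))
      = real (Suc s) * (b + real (Suc s) - 1) * g (real (Suc s) - 1) (real (Suc j - Suc s))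
        * (ucoeff b (Suc s) * X ^ Suc s * (ucoeff b (Suc j - Suc s) * Y ^ (Suc j - Suc s)))" for s
    by (subst ucoeff_Suc[OF assms, of s]) (simp del: of_nat_diff add: algebra_simps)
  show ?thesis
    unfolding uconv_def sum.atMost_Suc_shift sum_distrib_left shift by simp
qed

lemma uconv_swap: "uconv b X Y g j = uconv b Y X (\<lambda>s k. g k s) j"
  unfolding uconv_def
  by (rule sum.reindex_bij_witness[of _ "\<lambda>s. j - s" "\<lambda>s. j - s"]) auto

lemma uconv_mult_Y:
  assumes "b > 0"
  shows "Y * uconv b X Y g j = uconv b X Y (\<lambda>s k. k * (b + k - 1) * g s (k - 1)) (Suc j)"
  by (subst (1 2) uconv_swap) (simp add: uconv_mult_X[OF assms])

lemma uconv_cong: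
  assumes "\<And>s k. s + k = real j \<Longrightarrow> g s k = h s k"
  shows "uconv b X Y g j = uconv b X Y h j"
  unfolding uconv_def by (intro sum.cong refl) (simp add: assms)

lemma uconv_add: "uconv b X Y g j + uconv b X Y h j = uconv b X Y (\<lambda>s k. g s k + h s k) j"
  unfolding uconv_def by (simp add: sum.distrib[symmetric] algebra_simps)

lemma uconv_cmult: "c * uconv b X Y g j = uconv b X Y (\<lambda>s k. c * g s k) j"
  unfolding uconv_def by (simp add: sum_distrib_left mult.assoc)

text \<open>With \<open>X = (x - 1) / 2\<close> and \<open>Y = (x + 1) / 2\<close>, the identities
  \<open>x = X + Y\<close> and \<open>1 = (Y - X)^2\<close> lift all three terms to convolutions of
  index \<open>j + 2\<close>. What remains is a polynomial identity between weights on the line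
  \<open>s + k = j + 2\<close>.\<close>

lemma uconv_recurrence:
  fixes b x :: real and j :: nat
  assumes b: "b > 0"
  defines "q \<equiv> uconv b ((x - 1) / 2) ((x + 1) / 2) (\<lambda>s k. 1)"
  shows "(real j + 2 * b) * (real j + 2) * (real j + 1 + b) * (real j + b) * q (Suc (Suc j))
       = (2 * real j + 2 * b + 1) * (real j + b) * x * q (Suc j) - q j"
proof -
  define X Y where "X = (x - 1) / 2" and "Y = (x + 1) / 2"
  note mult = uconv_mult_X[OF b] uconv_mult_Y[OF b]
  have q: "q = uconv b X Y (\<lambda>s k. 1)"
    by (simp add: q_def X_def Y_def)
  have homog: "x = X + Y" "q j = X * (X * q j) + (-2) * (X * (Y * q j)) + Y * (Y * q j)"
    by (simp_all add: X_def Y_def field_simps)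
  have "(2 * real j + 2 * b + 1) * (real j + b) * x * q (Suc j) - q j
      = ((2 * real j + 2 * b + 1) * (real j + b)) * (X * q (Suc j) + Y * q (Suc j))
        + (-1) * (X * (X * q j) + (-2) * (X * (Y * q j)) + Y * (Y * q j))"
    by (subst homog(2)) (simp add: homog(1) algebra_simps)
  also have "\<dots> = (real j + 2 * b) * (real j + 2) * (real j + 1 + b) * (real j + b) * q (Suc (Suc j))"
    unfolding q mult
    unfolding uconv_add uconv_cmult
  proof (rule uconv_cong)
    fix s k :: real
    assume "s + k = real (Suc (Suc j))"
    then have "real j = s + k - 2"
      by simp
    then show "(2 * real j + 2 * b + 1) * (real j + b) * (s * (b + s - 1) * 1 + k * (b + k - 1) * 1)
        + (-1) * (s * (b + s - 1) * ((s - 1) * (b + (s - 1) - 1) * 1)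
          + (-2) * (s * (b + s - 1) * (k * (b + k - 1) * 1))
          + k * (b + k - 1) * ((k - 1) * (b + (k - 1) - 1) * 1))
      = (real j + 2 * b) * (real j + 2) * (real j + 1 + b) * (real j + b) * 1"
      by (simp only: of_nat_add of_nat_mult of_nat_numeral of_nat_1) (simp add: algebra_simps)
  qed
  finally show ?thesis
    by simp
qed

section \<open>Jacobi polynomials as convolutions\<close>

lemma gbinomial_eq_pochhammer_divide:
  fixes b :: real
  assumes "b > 0" "s \<le> j"
  shows "(real j + (b - 1)) gchoose (j - s) = pochhammer b j / (pochhammer b s * fact (j - s))"
proof -
  have "(real j + (b - 1)) gchoose (j - s) = pochhammer (b + real s) (j - s) / fact (j - s)"
    using assms by (simp add: gbinomial_pochhammer' of_nat_diff algebra_simps)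
  then show ?thesis
    using pochhammer_product[of s j b] assms pochhammer_pos[OF assms(1), of s]
    by (simp add: field_simps)
qed

text \<open>Each product of binomials is \<open>pochhammer b j ^ 2\<close> times two convolution
  coefficients. The value at 1 is \<open>pochhammer b j / fact j\<close>, so normalizing leaves the
  factor in front.\<close>

lemma poly_Pn_eq_uconv:
  assumes "n \<ge> 2"
  defines "b \<equiv> (real n - 1) / 2"
  shows "poly (Pn n j) x =
    fact j * pochhammer b j * uconv b ((x - 1) / 2) ((x + 1) / 2) (\<lambda>s k. 1) j"
proof -
  have b: "b > 0" and alpha: "(real n - 3) / 2 = b - 1"
    using assms(1) by (auto simp: b_def field_simps)
  have top: "(real j + (b - 1)) gchoose j = pochhammer b j / fact j"
    using gbinomial_eq_pochhammer_divide[OF b, of 0 j] by simp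
  have coeff: "((real j + (b - 1)) gchoose (j - s)) * ((real j + (b - 1)) gchoose s)
      = pochhammer b j ^ 2 * (ucoeff b s * ucoeff b (j - s))" if "s \<le> j" for s
    using gbinomial_eq_pochhammer_divide[OF b that]
      gbinomial_eq_pochhammer_divide[OF b, of "j - s" j] that
    by (simp add: ucoeff_def power2_eq_square)
  have "poly (jacobi_poly (b - 1) (b - 1) j) x
      = pochhammer b j ^ 2 * uconv b ((x - 1) / 2) ((x + 1) / 2) (\<lambda>s k. 1) j"
    unfolding jacobi_poly_def uconv_def poly_sum sum_distrib_left
  proof (rule sum.cong)
    fix s assume "s \<in> {..j}"
    then have "s \<le> j"
      by simp
    have lin: "(- 1 / 2) + x * (1 / 2) = (x - 1) / 2" "(1 / 2) + x * (1 / 2) = (x + 1) / 2"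
      by (simp_all add: field_simps)
    show "poly (smult (((real j + (b - 1)) gchoose (j - s)) * ((real j + (b - 1)) gchoose s))
        ([:- 1 / 2, 1 / 2:] ^ s * [:1 / 2, 1 / 2:] ^ (j - s))) x
      = pochhammer b j ^ 2 * (1 * (ucoeff b s * ((x - 1) / 2) ^ s
          * (ucoeff b (j - s) * ((x + 1) / 2) ^ (j - s))))"
      unfolding coeff[OF \<open>s \<le> j\<close>] poly_smult poly_mult poly_power poly_pCons poly_0
        mult_zero_right add_0_right lin
      by (simp only: mult_ac mult_1_left)
  qed simp
  then show ?thesis
    using pochhammer_pos[OF b, of j]
    by (simp add: Pn_def alpha Let_def poly_jacobi_poly_1 top power2_eq_square)
qed

lemma poly_Pn_0:
  assumes "n \<ge> 2"
  shows "poly (Pn n 0) x = 1"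
  using assms by (simp add: poly_Pn_eq_uconv uconv_def ucoeff_def)

lemma poly_Pn_Suc_0:
  assumes "n \<ge> 2"
  shows "poly (Pn n (Suc 0)) x = x"
proof -
  define b where "b = (real n - 1) / 2"
  have "b \<noteq> 0"
    using assms by (simp add: b_def)
  then show ?thesis
    unfolding poly_Pn_eq_uconv[OF assms] b_def[symmetric]
    by (simp add: uconv_def ucoeff_def field_simps)
qed

lemma poly_Pn_recurrence:
  fixes x :: real and j :: nat
  assumes "n \<ge> 2"
  defines "a \<equiv> (real j + 1) / (real j + real n - 1)"
  shows "poly (Pn n (Suc (Suc j))) x = (1 + a) * x * poly (Pn n (Suc j)) x - a * poly (Pn n j) x"
proof -
  define b q where "b = (real n - 1) / 2"
    and "q = uconv b ((x - 1) / 2) ((x + 1) / 2) (\<lambda>s k. 1)"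
  have b: "b > 0" and n: "real n = 2 * b + 1"
    using assms(1) by (auto simp: b_def field_simps)
  define w where "w = fact j * pochhammer b j"
  have P: "poly (Pn n i) x = fact i * pochhammer b i * q i" for i
    unfolding q_def b_def by (rule poly_Pn_eq_uconv[OF assms(1)])
  \<comment> \<open>As \<open>2 * j + 2 * b + 1 = (j + 2 * b) + (j + 1)\<close>, dividing the
    recurrence by \<open>j + 2 * b\<close> yields the coefficients \<open>1 + a\<close> and
    \<open>a\<close>.\<close>
  have a: "(real j + 2 * b) * a = real j + 1"
    using b by (simp add: a_def n)
  have "(real j + 2 * b) * poly (Pn n (Suc (Suc j))) x
      = (real j + 1) * w
        * ((real j + 2 * b) * (real j + 2) * (real j + 1 + b) * (real j + b) * q (Suc (Suc j)))"
    unfolding P w_def by (simp add: pochhammer_rec' algebra_simps)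
  also have "\<dots> = (real j + 1) * w * ((2 * real j + 2 * b + 1) * (real j + b) * x * q (Suc j) - q j)"
    unfolding q_def by (simp only: uconv_recurrence[OF b])
  also have "\<dots> = (real j + 2 * b + (real j + 1)) * x * poly (Pn n (Suc j)) x
      - (real j + 1) * poly (Pn n j) x"
    unfolding P w_def by (simp add: pochhammer_rec' algebra_simps)
  also have "\<dots> = (real j + 2 * b) * ((1 + a) * x * poly (Pn n (Suc j)) x - a * poly (Pn n j) x)"
    unfolding a[symmetric] by (simp add: algebra_simps)
  finally show ?thesis
    using b by simp
qed

section \<open>Damped Chebyshev recurrences\<close>

locale damped_chebyshev =
  fixes t :: real and a p :: "nat \<Rightarrow> real"
  assumes p_0: "p 0 = 1"
    and p_Suc_0: "p (Suc 0) = t"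
    and p_rec: "p (Suc (Suc j)) = (1 + a j) * t * p (Suc j) - a j * p j"
    and a_nonneg: "0 \<le> a j"
    and a_le_1: "a j \<le> 1"
    and t_bound: "0 < t" "t < 1"
begin

section \<open>Decay of the energy\<close>

definition energy :: "nat \<Rightarrow> real" where
  "energy j = p (Suc j) ^ 2 - 2 * t * p j * p (Suc j) + p j ^ 2"

text \<open>Put \<open>d = t * p (Suc j) - p j\<close>. Both energies are
  \<open>(1 - t\<^sup>2) * p (Suc j) ^ 2\<close> plus a square: that of \<open>d\<close> at
  \<open>j\<close>, and that of \<open>p (Suc (Suc j)) - t * p (Suc j) = a j * d\<close> at
  \<open>Suc j\<close>.\<close>

lemma energy_Suc:
  "energy (Suc j) = energy j - (1 - a j ^ 2) * (t * p (Suc j) - p j) ^ 2"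
  unfolding energy_def p_rec by (simp add: power2_eq_square algebra_simps)

lemma energy_ge: "(1 - t\<^sup>2) * p j ^ 2 \<le> energy j"
proof -
  have "energy j = (1 - t\<^sup>2) * p j ^ 2 + (p (Suc j) - t * p j) ^ 2"
    unfolding energy_def by (simp add: power2_eq_square algebra_simps)
  then show ?thesis
    by simp
qed

lemma t_sq: "0 < 1 - t\<^sup>2" "1 - t\<^sup>2 < 1"
  using t_bound by (simp_all add: power_less_one_iff)

lemma energy_antimono: "antimono energy"
proof (rule decseq_SucI)
  fix j
  have "a j ^ 2 \<le> 1"
    using a_nonneg a_le_1 by (simp add: power_le_one)
  then show "energy (Suc j) \<le> energy j"
    unfolding energy_Suc by simp
qed

text \<open>One step loses nothing when \<open>d = 0\<close>, hence two steps. The losses are at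
  least half of \<open>d ^ 2\<close> and of \<open>e ^ 2\<close>, and these two squares together
  control the energy.\<close>

lemma energy_Suc_Suc_le:
  assumes "a j \<le> 1 / 2" "a (Suc j) \<le> 1 / 2"
  shows "energy (Suc (Suc j)) \<le> (5 + t\<^sup>2) / 6 * energy j"
proof -
  define S d e where "S = 1 - t\<^sup>2" and "d = t * p (Suc j) - p j"
    and "e = t * p (Suc (Suc j)) - p (Suc j)"
  have S: "0 < S" "S < 1"
    using t_sq by (auto simp: S_def)
  have damp: "1 / 2 \<le> 1 - a i ^ 2" if "a i \<le> 1 / 2" for i
  proof -
    have "a i ^ 2 \<le> (1 / 2) ^ 2"
      using that a_nonneg by (rule power_mono)
    then show ?thesis
      by (simp add: power2_eq_square)
  qed
  have ta: "(t * a j) ^ 2 \<le> 1"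
    using t_bound a_nonneg[of j] a_le_1[of j] by (intro power_le_one) (auto intro: mult_le_one)
  \<comment> \<open>Inserting \<open>p (Suc (Suc j)) = t * p (Suc j) + a j * d\<close> into
    \<open>e\<close> gives \<open>S * p (Suc j) = t * a j * d - e\<close>.\<close>
  have "(S * p (Suc j)) ^ 2 = (t * a j * d - e) ^ 2"
    unfolding S_def d_def e_def p_rec by (simp add: power2_eq_square algebra_simps)
  also have "\<dots> \<le> 2 * ((t * a j * d) ^ 2 + e ^ 2)"
    using zero_le_power2[of "t * a j * d + e"] by (simp add: power2_eq_square algebra_simps)
  also have "\<dots> \<le> 2 * (d ^ 2 + e ^ 2)"
    using mult_right_mono[OF ta, of "d ^ 2"] by (simp add: power_mult_distrib)
  finally have "S ^ 2 * p (Suc j) ^ 2 \<le> 2 * (d ^ 2 + e ^ 2)"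
    by (simp add: power_mult_distrib)
  moreover have "S * d ^ 2 \<le> d ^ 2"
    using S by (simp add: mult_left_le_one_le)
  moreover have "S * energy j = S * d ^ 2 + S ^ 2 * p (Suc j) ^ 2"
    unfolding energy_def d_def S_def by (simp add: power2_eq_square algebra_simps)
  moreover have "0 \<le> e ^ 2"
    by simp
  ultimately have "S * energy j \<le> 3 * (d ^ 2 + e ^ 2)"
    by (simp only: distrib_left)
  moreover have "1 / 2 * d ^ 2 \<le> (1 - a j ^ 2) * d ^ 2"
    "1 / 2 * e ^ 2 \<le> (1 - a (Suc j) ^ 2) * e ^ 2"
    by (intro mult_right_mono damp assms zero_le_power2)+
  moreover have "energy (Suc (Suc j)) =
      energy j - (1 - a j ^ 2) * d ^ 2 - (1 - a (Suc j) ^ 2) * e ^ 2"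
    unfolding energy_Suc d_def e_def by simp
  ultimately have "energy (Suc (Suc j)) \<le> (1 - S / 6) * energy j"
    by (simp add: algebra_simps)
  moreover have "1 - S / 6 = (5 + t\<^sup>2) / 6"
    by (simp add: S_def field_simps)
  ultimately show ?thesis
    by simp
qed

text \<open>The factor \<open>1 - t\<^sup>2\<close> is \<open>energy 0\<close>; it later cancels
  against the one in \<open>energy_ge\<close>.\<close>

lemma energy_decay:
  assumes "\<And>j. j < 2 * k \<Longrightarrow> a j \<le> 1 / 2"
  shows "energy (2 * k) \<le> ((5 + t\<^sup>2) / 6) ^ k * (1 - t\<^sup>2)"
  using assms
proof (induction k)
  case 0
  then show ?case
    by (simp add: energy_def p_0 p_Suc_0 power2_eq_square)
next
  case (Suc k)
  have "energy (2 * Suc k) \<le> (5 + t\<^sup>2) / 6 * energy (2 * k)"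
    using energy_Suc_Suc_le[of "2 * k"] Suc.prems by simp
  also have "\<dots> \<le> (5 + t\<^sup>2) / 6 * (((5 + t\<^sup>2) / 6) ^ k * (1 - t\<^sup>2))"
  proof (rule mult_left_mono)
    show "0 \<le> (5 + t\<^sup>2) / 6"
      by simp
  qed (use Suc in auto)
  finally show ?case
    by (simp add: mult.assoc)
qed

text \<open>The first \<open>2 * k\<close> steps provide the decay; monotonicity of the energy
  carries the bound to all later indices, where \<open>a\<close> may be close to 1.\<close>

lemma p_sq_decay:
  assumes "\<And>j. j < 2 * k \<Longrightarrow> a j \<le> 1 / 2" and "2 * k \<le> i"
  shows "p i ^ 2 \<le> ((5 + t\<^sup>2) / 6) ^ k"
proof -
  have "(1 - t\<^sup>2) * p i ^ 2 \<le> energy (2 * k)"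
    using energy_ge[of i] antimonoD[OF energy_antimono assms(2)] by linarith
  also have "\<dots> \<le> (1 - t\<^sup>2) * ((5 + t\<^sup>2) / 6) ^ k"
    using energy_decay[OF assms(1)] by (simp add: mult.commute)
  finally show ?thesis
    using t_sq by (simp only: mult_le_cancel_left_pos)
qed

text \<open>The ratio bound is what makes the induction work: it gives
  \<open>a j * p j \<le> t / 2 * p (Suc j)\<close>, so subtracting this term costs at most half of
  \<open>t * p (Suc j)\<close>.\<close>

lemma p_growth:
  assumes "\<And>i. i < j \<Longrightarrow> a i \<le> t\<^sup>2 / 4"
  shows "0 < p j \<and> t / 2 * p j \<le> p (Suc j)"
  using assms
proof (induction j)
  case 0
  then show ?case
    using t_bound by (simp add: p_0 p_Suc_0)
next
  case (Suc j)
  then have IH: "0 < p j" "t / 2 * p j \<le> p (Suc j)" and aj: "a j \<le> t\<^sup>2 / 4"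
    by auto
  have pos: "0 < p (Suc j)"
    using IH t_bound by (intro less_le_trans[OF mult_pos_pos IH(2)]) auto
  have "a j * p j \<le> t\<^sup>2 / 4 * p j"
    using aj IH(1) by (intro mult_right_mono) auto
  also have "\<dots> = t / 2 * (t / 2 * p j)"
    by (simp add: power2_eq_square)
  also have "\<dots> \<le> t / 2 * p (Suc j)"
    using IH t_bound by (intro mult_left_mono) auto
  moreover have "0 \<le> a j * t * p (Suc j)"
    using a_nonneg t_bound pos by simp
  ultimately have "t / 2 * p (Suc j) \<le> p (Suc (Suc j))"
    unfolding p_rec by (simp add: algebra_simps)
  with pos show ?case
    by simp
qed

end

section \<open>The minimum\<close>

lemma damped_chebyshev_Pn:
  assumes "n \<ge> 2" "0 < t" "t < 1"
  shows "damped_chebyshev t (\<lambda>j. (real j + 1) / (real j + real n - 1)) (\<lambda>j. poly (Pn n j) t)"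
  using assms by unfold_locales
    (simp_all add: poly_Pn_0 poly_Pn_Suc_0 poly_Pn_recurrence)

text \<open>The index \<open>2 * k\<close> separates two regimes. Below it all coefficients are at
  most \<open>t\<^sup>2 / 4\<close>, which gives positivity there and, being below 1/2, decay from
  \<open>2 * k\<close> on.\<close>

lemma abs_Mn_le:
  assumes "n \<ge> 2" "0 < t" "t < 1"
    and k: "real (2 * k) \<le> t\<^sup>2 / 4 * (real n - 2)"
  shows "\<bar>Mn n t\<bar> \<le> sqrt (((5 + t\<^sup>2) / 6) ^ k)"
proof -
  interpret damped_chebyshev t "\<lambda>j. (real j + 1) / (real j + real n - 1)" "\<lambda>j. poly (Pn n j) t"
    using assms(1-3) by (rule damped_chebyshev_Pn)
  let ?B = "sqrt (((5 + t\<^sup>2) / 6) ^ k)"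
  have t2: "0 < t\<^sup>2" "t\<^sup>2 < 1"
    using t_sq assms by auto
  have small: "(real j + 1) / (real j + real n - 1) \<le> t\<^sup>2 / 4" if "j < 2 * k" for j
  proof -
    have "real j + 1 \<le> t\<^sup>2 / 4 * (real n - 2)"
      using that k by linarith
    also have "\<dots> \<le> t\<^sup>2 / 4 * (real j + real n - 1)"
      using t2 by (intro mult_left_mono) auto
    finally show ?thesis
      using assms(1) by (simp add: field_simps)
  qed
  have large: "\<bar>poly (Pn n j) t\<bar> \<le> ?B" if "2 * k \<le> j" for j
  proof -
    have "poly (Pn n j) t ^ 2 \<le> ((5 + t\<^sup>2) / 6) ^ k"
    proof (rule p_sq_decay)
      show "2 * k \<le> j"
        by (fact that)
    next
      fix i assume "i < 2 * k"
      then show "(real i + 1) / (real i + real n - 1) \<le> 1 / 2"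
        using small[of i] t2 by linarith
    qed
    then show ?thesis
      using real_le_rsqrt[of "\<bar>poly (Pn n j) t\<bar>"] by simp
  qed
  have B: "0 \<le> ?B"
    by simp
  have lower: "- ?B \<le> poly (Pn n j) t" for j
  proof (cases "2 * k \<le> j")
    case True
    then show ?thesis
      using large[of j] by linarith
  next
    case False
    then have "0 < poly (Pn n j) t"
      using p_growth[of j] small by simp
    with B show ?thesis
      by linarith
  qed
  have "- ?B \<le> Mn n t"
    unfolding Mn_def using lower by (intro cINF_greatest) auto
  \<comment> \<open>Any single value bounds the infimum from above; the one at \<open>2 * k\<close>
    is already small.\<close>
  moreover have "Mn n t \<le> poly (Pn n (2 * k)) t"
    unfolding Mn_def using lower by (intro cINF_lower bdd_belowI2[of _ "- ?B"]) auto
  ultimately show ?thesis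
    using large[of "2 * k"] by linarith
qed

theorem theorem4p1:
  "\<forall>t::real. 0 < t \<and> t < 1 \<longrightarrow>
     (\<exists>c::real. 0 < c \<and> c < 1 \<and>
       (\<exists>\<epsilon>::nat \<Rightarrow> real. \<epsilon> \<longlonglongrightarrow> 0 \<and>
          (\<forall>n\<ge>2. \<bar>Mn n t\<bar> \<le> (c + \<epsilon> n) ^ n)))"
proof (intro allI impI)
  fix t :: real
  assume t: "0 < t \<and> t < 1"
  then have t2: "0 < t\<^sup>2" "t\<^sup>2 < 1"
    by (simp_all add: power_less_one_iff)
  define r where "r = (5 + t\<^sup>2) / 6"
  \<comment> \<open>Roughly \<open>k = t\<^sup>2 / 8 * n\<close> is admissible in
    \<open>abs_Mn_le\<close>, and the square root halves the exponent of \<open>r\<close>.\<close>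
  define c where "c = r powr (t\<^sup>2 / 16)"
  \<comment> \<open>Chosen so that \<open>c + eps n = r powr (t\<^sup>2 / 16 - 1 / n)\<close>: its
    \<open>n\<close>-th power leaves a spare factor \<open>1 / r\<close> for rounding
    losses.\<close>
  define eps where "eps = (\<lambda>n::nat. c * (r powr (- 1 / real n) - 1))"
  have r: "0 < r" "r < 1"
    using t2 by (auto simp: r_def add_pos_nonneg)
  have "0 < c"
    using r by (simp add: c_def)
  moreover have "c < 1"
    unfolding c_def using r t2 powr_less_mono'[of r 0 "t\<^sup>2 / 16"] by simp
  moreover have "eps \<longlonglongrightarrow> 0"
  proof -
    have "(\<lambda>n. - 1 / real n) \<longlonglongrightarrow> 0"
      by (rule lim_const_over_n)
    then have "(\<lambda>n. r powr (- 1 / real n)) \<longlonglongrightarrow> r powr 0"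
      using r by (intro tendsto_intros) auto
    then have "eps \<longlonglongrightarrow> c * (r powr 0 - 1)"
      unfolding eps_def by (intro tendsto_mult tendsto_diff tendsto_const)
    then show ?thesis
      using r by simp
  qed
  moreover have "\<bar>Mn n t\<bar> \<le> (c + eps n) ^ n" if n: "n \<ge> 2" for n
  proof -
    define y where "y = t\<^sup>2 / 8 * (real n - 2)"
    define k where "k = nat \<lfloor>y\<rfloor>"
    have "0 \<le> y"
      using n t2 by (simp add: y_def)
    then have k: "real k \<le> y" "y < real k + 1"
      unfolding k_def by linarith+
    have "\<bar>Mn n t\<bar> \<le> sqrt (r ^ k)"
      unfolding r_def using n t k by (intro abs_Mn_le) (auto simp: y_def)
    also have "\<dots> = r powr (real k / 2)"
      using r by (simp add: powr_half_sqrt[symmetric] powr_realpow[symmetric] powr_powr)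
    also have "\<dots> \<le> r powr (t\<^sup>2 / 16 * real n - 1)"
    proof (rule powr_mono')
      \<comment> \<open>The floor costs less than 1/2 and the shift \<open>n - 2\<close> costs
        \<open>t\<^sup>2 / 8\<close>, together less than 1.\<close>
      have "t\<^sup>2 / 16 * real n = y / 2 + t\<^sup>2 / 8"
        by (simp add: y_def field_simps)
      then show "t\<^sup>2 / 16 * real n - 1 \<le> real k / 2"
        using t2 k by linarith
    qed (use r in auto)
    also have "t\<^sup>2 / 16 * real n - 1 = (t\<^sup>2 / 16 + - 1 / real n) * real n"
      using n by (simp add: field_simps)
    also have "r powr \<dots> = (r powr (t\<^sup>2 / 16 + - 1 / real n)) ^ n"
      using r by (simp add: powr_powr[symmetric] powr_realpow)
    also have "r powr (t\<^sup>2 / 16 + - 1 / real n) = c + eps n"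
      unfolding powr_add by (simp add: eps_def c_def algebra_simps)
    finally show ?thesis .
  qed
  ultimately show "\<exists>c>0. c < 1 \<and>
      (\<exists>\<epsilon>. \<epsilon> \<longlonglongrightarrow> 0 \<and> (\<forall>n\<ge>2. \<bar>Mn n t\<bar> \<le> (c + \<epsilon> n) ^ n))"
    by blast
qed

end
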